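(* We have $$A^{2143}(x,q)=1+I^{2143}(x,q)+x\left(A^{2143}(x,q)-1\right)+\frac{x}{1-x}\left(I^{2143}(x,q)-x\right).$$ Moreover, $$I^{2143}(x)=(1-x)^2E(x)+2x-1,$$ $I^{2143}_1=1$, and for $n\ge2$, $I^{2143}_n=E_n-2E_{n-1}+E_{n-2}$, where $E_m$ is the number of $1234$-avoiding permutations of $[m]$ ($E_0=1$) and $E(x)=\sum_{m\ge0}E_mx^m$.
   Context: For a permutation $\pi=\pi_1\cdots\pi_n$ of $[n]$, let $i_\pi$ be the smallest index $i$ with $\{\pi_1,\dots,\pi_i\}=\{1,\dots,i\}$; $\pi$ is indecomposable if $i_\pi=n$ (the empty permutation is not indecomposable). A permutation $\pi$ avoids a pattern $\tau\in\mathfrak S_k$ if no subsequence $\pi_{j_1}\cdots\pi_{j_k}$ ($j_1<\cdots<j_k$) is order-isomorphic to $\tau$. A descent of $\pi$ is an index $i$ with $\pi_i>\pi_{i+1}$. For a pattern $\sigma$, $A^\sigma_{n,i}$ (resp. $I^\sigma_{n,i}$) is the number of $\sigma$-avoiding permutations (resp. $\sigma$-avoiding indecomposable permutations) of $[n]$ with $i$ descents; $A^\sigma(x,q)=1+\sum_{n\ge1}\sum_iA^\sigma_{n,i}x^nq^i$, $I^\sigma(x,q)=\sum_{n\ge1}\sum_iI^\sigma_{n,i}x^nq^i$, $I^\sigma(x)=I^\sigma(x,1)=\sum_{n\ge1}I^\sigma_nx^n$. It is known that $1234$ and $2143$ are Wilf-equivalent, i.e. $E_m$ also equals the number of $2143$-avoiding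 permutations of $[m]$. *)

theory Defs
  imports
    "HOL-Combinatorics.Multiset_Permutations"
    "HOL-Library.Sublist"
    "HOL-Computational_Algebra.Formal_Power_Series"
begin

text \<open>
  A permutation of \<open>[n]\<close> is its one-line word, i.e. an element of
  \<^term>\<open>permutations_of_set {1..n}\<close>. List positions start at 0, so the letter written
  \<open>\<pi>\<^sub>i\<close> on paper is \<open>\<pi> ! (i - 1)\<close>.
\<close>

definition order_isomorphic :: "nat list \<Rightarrow> nat list \<Rightarrow> bool" where
  "order_isomorphic xs ys \<longleftrightarrow> length xs = length ys \<and>
     (\<forall>a < length xs. \<forall>b < length xs. xs ! a < xs ! b \<longleftrightarrow> ys ! a < ys ! b)"

definition avoids :: "nat list \<Rightarrow> nat list \<Rightarrow> bool" where
  "avoids \<pi> \<tau> \<longleftrightarrow> \<not> (\<exists>xs. subseq xs \<pi> \<and> order_isomorphic xs \<tau>)"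

definition descents :: "nat list \<Rightarrow> nat set" where
  "descents \<pi> = {i. Suc i < length \<pi> \<and> \<pi> ! i > \<pi> ! Suc i}"

text \<open>The index ranges over positive integers; at 0 the condition would hold trivially.\<close>

definition first_return :: "nat list \<Rightarrow> nat" where
  "first_return \<pi> = (LEAST i. 1 \<le> i \<and> set (take i \<pi>) = {1..i})"

definition indecomposable :: "nat list \<Rightarrow> bool" where
  "indecomposable \<pi> \<longleftrightarrow> \<pi> \<noteq> [] \<and> first_return \<pi> = length \<pi>"

definition avoiders :: "nat list \<Rightarrow> nat \<Rightarrow> nat list set" where
  "avoiders \<sigma> n = {\<pi> \<in> permutations_of_set {1..n}. avoids \<pi> \<sigma>}"

definition indec_avoiders :: "nat list \<Rightarrow> nat \<Rightarrow> nat list set" where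
  "indec_avoiders \<sigma> n = {\<pi> \<in> avoiders \<sigma> n. indecomposable \<pi>}"

definition A_count :: "nat list \<Rightarrow> nat \<Rightarrow> nat \<Rightarrow> nat" where
  "A_count \<sigma> n i = card {\<pi> \<in> avoiders \<sigma> n. card (descents \<pi>) = i}"

definition I_count :: "nat list \<Rightarrow> nat \<Rightarrow> nat \<Rightarrow> nat" where
  "I_count \<sigma> n i = card {\<pi> \<in> indec_avoiders \<sigma> n. card (descents \<pi>) = i}"

definition I_total :: "nat list \<Rightarrow> nat \<Rightarrow> nat" where
  "I_total \<sigma> n = card (indec_avoiders \<sigma> n)"

text \<open>
  A series in \<open>x\<close> and \<open>q\<close> is a power series in \<open>x\<close> whose coefficients are power series in \<open>q\<close>:
  the coefficient of \<open>x\<^sup>n q\<^sup>i\<close> in \<open>F\<close> is \<open>fps_nth (fps_nth F n) i\<close>, and the variable \<open>x\<close> is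
  \<^term>\<open>fps_X :: rat fps fps\<close>. Rational coefficients make the library's inverse available.
\<close>

definition A_gf :: "nat list \<Rightarrow> rat fps fps" where
  "A_gf \<sigma> = 1 + Abs_fps (\<lambda>n. if n \<ge> 1 then Abs_fps (\<lambda>i. of_nat (A_count \<sigma> n i)) else 0)"

definition I_gf :: "nat list \<Rightarrow> rat fps fps" where
  "I_gf \<sigma> = Abs_fps (\<lambda>n. if n \<ge> 1 then Abs_fps (\<lambda>i. of_nat (I_count \<sigma> n i)) else 0)"

text \<open>Substitution of 1 for \<open>q\<close>, for series whose \<open>x\<close>-coefficients are polynomials in \<open>q\<close>.\<close>

definition at_q1 :: "rat fps fps \<Rightarrow> rat fps" where
  "at_q1 F = Abs_fps (\<lambda>n. \<Sum>i | fps_nth (fps_nth F n) i \<noteq> 0. fps_nth (fps_nth F n) i)"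

definition I_gf1 :: "nat list \<Rightarrow> rat fps" where
  "I_gf1 \<sigma> = at_q1 (I_gf \<sigma>)"

definition E_count :: "nat \<Rightarrow> nat" where
  "E_count m = card (avoiders [1,2,3,4] m)"

definition E_gf :: "rat fps" where
  "E_gf = Abs_fps (\<lambda>m. of_nat (E_count m))"

lemma finite_indec_avoiders: "finite (indec_avoiders \<sigma> n)"
  by (simp add: indec_avoiders_def avoiders_def)

lemma indec_avoiders_0: "indec_avoiders \<sigma> 0 = {}"
  by (auto simp: indec_avoiders_def avoiders_def indecomposable_def)

lemma I_gf1_eq: "I_gf1 \<sigma> = Abs_fps (\<lambda>n. of_nat (I_total \<sigma> n))"
proof (rule fps_ext)
  fix n
  let ?S = "indec_avoiders \<sigma> n" and ?d = "\<lambda>\<pi>. card (descents \<pi>)"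
  have *: "{i. I_count \<sigma> n i \<noteq> 0} = ?d ` ?S"
    using finite_indec_avoiders[of \<sigma> n] by (auto simp: I_count_def)
  have "(\<Sum>i | I_count \<sigma> n i \<noteq> 0. I_count \<sigma> n i) = card ?S"
    unfolding * using sum.image_gen[OF finite_indec_avoiders, of "\<lambda>_. 1 :: nat" \<sigma> n ?d]
    by (simp add: I_count_def)
  moreover have "I_total \<sigma> 0 = 0"
    by (simp add: I_total_def indec_avoiders_0)
  ultimately show "fps_nth (I_gf1 \<sigma>) n = fps_nth (Abs_fps (\<lambda>n. of_nat (I_total \<sigma> n))) n"
    by (cases "n = 0") (auto simp: I_gf1_def at_q1_def I_gf_def I_total_def simp flip: of_nat_sum)
qed

lemma fps_X_div_one_minus_fps_X:
  "(fps_X / (1 - fps_X) :: rat fps fps) = fps_X * Abs_fps (\<lambda>n. 1)"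
proof -
  let ?f = "1 - fps_X :: rat fps fps" and ?g = "Abs_fps (\<lambda>n. 1) :: rat fps fps"
  have f0: "fps_nth ?f 0 = 1"
    by simp
  hence sd: "subdegree ?f = 0" and nz: "?f \<noteq> 0"
    by (force intro: subdegreeI, metis fps_zero_nth zero_neq_one)
  have 1: "?g * ?f = 1"
    by (rule fps_ext) (simp add: right_diff_distrib)
  have 2: "?f * inverse ?f = 1"
    unfolding fps_inverse_def[of ?f] by (rule fps_right_inverse) simp
  have "inverse ?f = (?g * ?f) * inverse ?f"
    by (simp only: 1 mult_1_left)
  also have "\<dots> = ?g"
    by (simp only: mult.assoc 2 mult_1_right)
  finally show ?thesis
    using sd nz by (simp only: fps_divide_def fps_unit_factor_def Let_def if_False fps_shift_0)
qed

end

theory Submission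
  imports Defs
begin

text \<open>
  Split a nonempty 2143-avoider as \<open>\<pi> = \<alpha> \<oplus> \<beta>\<close> with \<open>\<alpha>\<close> its first indecomposable component. If
  \<open>\<alpha> = 1\<close>, then \<open>\<beta>\<close> is an arbitrary 2143-avoider; if \<open>\<alpha>\<close> has length at least 2, it contains a 21,
  which forces \<open>\<beta>\<close> to be increasing. This gives the equation for \<open>A(x, q)\<close>; at \<open>q = 1\<close> it determines
  \<open>I(x)\<close> from the number of 2143-avoiders.

  That number is \<open>E\<^sub>n\<close> because \<open>12 \<oplus> \<tau>\<close> and \<open>21 \<oplus> \<tau>\<close> are Wilf-equivalent for every \<open>\<tau>\<close> of length 2:
  1234 and 2134 are equivalent, 2134 and 1243 are by reverse complement, and 1243 and 2143 are. For
  the equivalence, group the permutations by their points that have no occurrence of \<open>\<tau>\<close> to the upper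
  right. The group does not change when two of the remaining points that form the first half of
  an occurrence of \<open>12 \<oplus> \<tau>\<close> or \<open>21 \<oplus> \<tau>\<close> exchange their values, and each group contains exactly one
  avoider of either pattern.
\<close>

section \<open>Occurrences of length-4 patterns in terms of positions\<close>

lemma subseq_Cons_iff_nth:
  "subseq (x # xs) ys \<longleftrightarrow> (\<exists>i<length ys. ys ! i = x \<and> subseq xs (drop (Suc i) ys))"
proof
  assume "subseq (x # xs) ys"
  then obtain us v vs where "ys = us @ v # vs" "x = v" "subseq xs vs"
    by (auto dest: list_emb_ConsD)
  then show "\<exists>i<length ys. ys ! i = x \<and> subseq xs (drop (Suc i) ys)"
    by (intro exI[of _ "length us"]) auto
next
  assume "\<exists>i<length ys. ys ! i = x \<and> subseq xs (drop (Suc i) ys)"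
  then obtain i where i: "i < length ys" "ys ! i = x" "subseq xs (drop (Suc i) ys)"
    by blast
  then have "ys = take i ys @ x # drop (Suc i) ys"
    using id_take_nth_drop by blast
  moreover have "subseq (x # xs) (take i ys @ x # drop (Suc i) ys)"
    using i(3) by (intro list_emb_append2) auto
  ultimately show "subseq (x # xs) ys" by simp
qed

text \<open>Turns positions relative to the suffix into positions in \<open>ys\<close>, so that
  peeling letters off a subsequence yields increasing absolute positions.\<close>

lemma ex_nth_drop:
  "(\<exists>i<length (drop m ys). P (drop m ys ! i) (drop (Suc i) (drop m ys))) \<longleftrightarrow>
   (\<exists>i\<ge>m. i < length ys \<and> P (ys ! i) (drop (Suc i) ys))"
proof
  assume "\<exists>i<length (drop m ys). P (drop m ys ! i) (drop (Suc i) (drop m ys))"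
  then obtain i where "i < length ys - m" "P (ys ! (m + i)) (drop (Suc (m + i)) ys)"
    by (auto simp: add.commute)
  then show "\<exists>i\<ge>m. i < length ys \<and> P (ys ! i) (drop (Suc i) ys)"
    by (intro exI[of _ "m + i"]) auto
next
  assume "\<exists>i\<ge>m. i < length ys \<and> P (ys ! i) (drop (Suc i) ys)"
  then obtain i where "i \<ge> m" "i < length ys" "P (ys ! i) (drop (Suc i) ys)" by blast
  then show "\<exists>i<length (drop m ys). P (drop m ys ! i) (drop (Suc i) (drop m ys))"
    by (intro exI[of _ "i - m"]) auto
qed

lemma subseq_4_iff_nth:
  "subseq [a, b, c, d] ys \<longleftrightarrow>
   (\<exists>i j k l. i < j \<and> j < k \<and> k < l \<and> l < length ys \<and>
      ys ! i = a \<and> ys ! j = b \<and> ys ! k = c \<and> ys ! l = d)"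
proof -
  have step: "subseq (x # xs) (drop m ys) \<longleftrightarrow>
      (\<exists>i\<ge>m. i < length ys \<and> ys ! i = x \<and> subseq xs (drop (Suc i) ys))" for x xs m
    unfolding subseq_Cons_iff_nth by (rule ex_nth_drop[where P = "\<lambda>y zs. y = x \<and> subseq xs zs"])
  have "subseq [a, b, c, d] ys \<longleftrightarrow> subseq [a, b, c, d] (drop 0 ys)" by simp
  also have "\<dots> \<longleftrightarrow> (\<exists>i j k l. i < j \<and> j < k \<and> k < l \<and> l < length ys \<and>
      ys ! i = a \<and> ys ! j = b \<and> ys ! k = c \<and> ys ! l = d)"
  proof
    assume "subseq [a, b, c, d] (drop 0 ys)"
    then show "\<exists>i j k l. i < j \<and> j < k \<and> k < l \<and> l < length ys \<and>
      ys ! i = a \<and> ys ! j = b \<and> ys ! k = c \<and> ys ! l = d"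
      unfolding step Suc_le_eq by blast
  next
    assume "\<exists>i j k l. i < j \<and> j < k \<and> k < l \<and> l < length ys \<and>
      ys ! i = a \<and> ys ! j = b \<and> ys ! k = c \<and> ys ! l = d"
    then obtain i j k l where "i < j" "j < k" "k < l" "l < length ys"
      "ys ! i = a" "ys ! j = b" "ys ! k = c" "ys ! l = d" by blast
    moreover from this have "i < length ys" "j < length ys" "k < length ys" by simp_all
    ultimately show "subseq [a, b, c, d] (drop 0 ys)"
      unfolding step Suc_le_eq using list_emb_Nil by blast
  qed
  finally show ?thesis .
qed

lemma all_less_4: "(\<forall>a<4. P a) \<longleftrightarrow> P 0 \<and> P 1 \<and> P 2 \<and> P (3::nat)"
  by (auto simp: numeral_eq_Suc less_Suc_eq)

lemma length_eq_4_iff: "length xs = 4 \<longleftrightarrow> (\<exists>a b c d. xs = [a, b, c, d])"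
  by (auto simp: numeral_eq_Suc length_Suc_conv)

text \<open>For a concrete pattern the quantifiers over \<open>zip\<close> evaluate to a finite
  conjunction of comparisons.\<close>

lemma order_isomorphic_4:
  "order_isomorphic xs [p, q, r, s] \<longleftrightarrow>
   (\<exists>a b c d. xs = [a, b, c, d] \<and> (\<forall>(x, u) \<in> set (zip xs [p, q, r, s]).
      \<forall>(y, v) \<in> set (zip xs [p, q, r, s]). x < y \<longleftrightarrow> u < v))"
proof (cases "length xs = 4")
  case True
  then obtain a b c d where "xs = [a, b, c, d]" unfolding length_eq_4_iff by blast
  moreover have "length [a, b, c, d] = 4" by simp
  ultimately show ?thesis
    unfolding order_isomorphic_def by (simp only: all_less_4) (auto simp: numeral_eq_Suc)
next
  case False
  then show ?thesis by (auto simp add: order_isomorphic_def)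
qed

definition contains_at :: "(nat \<Rightarrow> nat \<Rightarrow> nat \<Rightarrow> nat \<Rightarrow> bool) \<Rightarrow> nat list \<Rightarrow> bool" where
  "contains_at P ys \<longleftrightarrow> (\<exists>i j k l. i < j \<and> j < k \<and> k < l \<and> l < length ys \<and>
     P (ys ! i) (ys ! j) (ys ! k) (ys ! l))"

lemma avoids_4:
  assumes "\<And>a b c d. order_isomorphic [a, b, c, d] [p, q, r, s] \<longleftrightarrow> P a b c d"
  shows "avoids ys [p, q, r, s] \<longleftrightarrow> \<not> contains_at P ys"
proof -
  have "(\<exists>xs. subseq xs ys \<and> order_isomorphic xs [p, q, r, s]) \<longleftrightarrow>
        (\<exists>a b c d. subseq [a, b, c, d] ys \<and> P a b c d)"
  proof
    assume "\<exists>xs. subseq xs ys \<and> order_isomorphic xs [p, q, r, s]"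
    then obtain xs where xs: "subseq xs ys" "order_isomorphic xs [p, q, r, s]" by blast
    moreover from xs(2) obtain a b c d where "xs = [a, b, c, d]"
      unfolding order_isomorphic_4 by blast
    ultimately show "\<exists>a b c d. subseq [a, b, c, d] ys \<and> P a b c d" using assms by blast
  qed (use assms in blast)
  then show ?thesis
    unfolding avoids_def contains_at_def subseq_4_iff_nth by blast
qed

lemma avoids_1234:
  "avoids ys [1, 2, 3, 4] \<longleftrightarrow> \<not> contains_at (\<lambda>a b c d. a < b \<and> b < c \<and> c < d) ys"
  and avoids_1243:
  "avoids ys [1, 2, 4, 3] \<longleftrightarrow> \<not> contains_at (\<lambda>a b c d. a < b \<and> b < d \<and> d < c) ys"
  and avoids_2134:
  "avoids ys [2, 1, 3, 4] \<longleftrightarrow> \<not> contains_at (\<lambda>a b c d. b < a \<and> a < c \<and> c < d) ys"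
  and avoids_2143:
  "avoids ys [2, 1, 4, 3] \<longleftrightarrow> \<not> contains_at (\<lambda>a b c d. b < a \<and> a < d \<and> d < c) ys"
  by (rule avoids_4; auto simp: order_isomorphic_4)+

subsection \<open>Wilf equivalence of 1234 and 2143\<close>

text \<open>
  The relation \<open>R\<close> stands for a pattern \<open>\<tau>\<close> of length 2: \<open>(<)\<close> encodes 12 and \<open>(>)\<close> encodes 21.
  A cell \<open>(i, v)\<close> (position, value) is white if an occurrence of \<open>\<tau>\<close> lies strictly to its right
  and above it.
\<close>

definition white :: "(nat \<Rightarrow> nat \<Rightarrow> bool) \<Rightarrow> nat list \<Rightarrow> nat \<Rightarrow> nat \<Rightarrow> bool" where
  "white R \<pi> i v \<longleftrightarrow> (\<exists>k l. i < k \<and> k < l \<and> l < length \<pi> \<and> v < \<pi> ! k \<and> v < \<pi> ! l \<and> R (\<pi> ! k) (\<pi> ! l))"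

definition black :: "(nat \<Rightarrow> nat \<Rightarrow> bool) \<Rightarrow> nat list \<Rightarrow> (nat \<times> nat) set" where
  "black R \<pi> = {(i, \<pi> ! i) |i. i < length \<pi> \<and> \<not> white R \<pi> i (\<pi> ! i)}"

text \<open>The pattern is \<open>\<sigma> \<oplus> \<tau>\<close> where \<open>S\<close> encodes \<open>\<sigma>\<close> and \<open>R\<close> encodes \<open>\<tau>\<close>.\<close>

definition contains_sum ::
  "(nat \<Rightarrow> nat \<Rightarrow> bool) \<Rightarrow> (nat \<Rightarrow> nat \<Rightarrow> bool) \<Rightarrow> nat list \<Rightarrow> bool" where
  "contains_sum S R \<pi> \<longleftrightarrow>
     (\<exists>i j. i < j \<and> S (\<pi> ! i) (\<pi> ! j) \<and> white R \<pi> j (max (\<pi> ! i) (\<pi> ! j)))"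

lemma white_mono: "white R \<pi> i v \<Longrightarrow> i' \<le> i \<Longrightarrow> v' \<le> v \<Longrightarrow> white R \<pi> i' v'"
  unfolding white_def by (meson le_less_trans)

lemma white_black_witnesses:
  assumes "white R \<pi> i v"
  shows "\<exists>k l. i < k \<and> k < l \<and> (k, \<pi> ! k) \<in> black R \<pi> \<and> (l, \<pi> ! l) \<in> black R \<pi> \<and>
           v < \<pi> ! k \<and> v < \<pi> ! l \<and> R (\<pi> ! k) (\<pi> ! l)"
  using assms
proof (induction "length \<pi> - i" arbitrary: i v rule: less_induct)
  case less
  from less.prems obtain k l where kl: "i < k" "k < l" "l < length \<pi>"
      "v < \<pi> ! k" "v < \<pi> ! l" "R (\<pi> ! k) (\<pi> ! l)"
    unfolding white_def by blast
  \<comment> \<open>If one of the two letters is white, an occurrence to its upper right also serves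
    \<open>(i, v)\<close>. The start moves right each time, so the replacement ends with two black
    letters.\<close>
  consider "white R \<pi> k (\<pi> ! k)" | "white R \<pi> l (\<pi> ! l)"
    | "\<not> white R \<pi> k (\<pi> ! k)" "\<not> white R \<pi> l (\<pi> ! l)" by blast
  then show ?case
  proof cases
    case 1
    from less.hyps[OF _ 1] kl show ?thesis by (meson diff_less_mono2 less_trans)
  next
    case 2
    from less.hyps[OF _ 2] kl show ?thesis by (meson diff_less_mono2 less_trans)
  next
    case 3
    with kl show ?thesis unfolding black_def
      by (intro exI[of _ k] exI[of _ l]) auto
  qed
qed

text \<open>Witnesses can be taken black, so the white region depends on \<open>\<pi>\<close> only
  through \<open>black R \<pi>\<close>.\<close>

lemma white_iff_black:
  "white R \<pi> i v \<longleftrightarrow> (\<exists>(k, x) \<in> black R \<pi>. \<exists>(l, y) \<in> black R \<pi>. i < k \<and> k < l \<and> v < x \<and> v < y \<and> R x y)"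
proof
  assume "white R \<pi> i v"
  from white_black_witnesses[OF this]
  show "\<exists>(k, x) \<in> black R \<pi>. \<exists>(l, y) \<in> black R \<pi>. i < k \<and> k < l \<and> v < x \<and> v < y \<and> R x y"
    by fast
next
  assume "\<exists>(k, x) \<in> black R \<pi>. \<exists>(l, y) \<in> black R \<pi>. i < k \<and> k < l \<and> v < x \<and> v < y \<and> R x y"
  then show "white R \<pi> i v" unfolding black_def white_def by blast
qed

lemma white_cong_black: "black R \<pi> = black R \<rho> \<Longrightarrow> white R \<pi> = white R \<rho>"
  by (intro ext) (simp add: white_iff_black)

text \<open>One inclusion of white regions, for use before the black points of \<open>\<rho>\<close>
  are known: \<open>\<rho>\<close> only has to keep the black letters of
  \<open>\<pi>\<close>.\<close>

lemma white_if_agree_on_black: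
  assumes "white R \<pi> i v" "length \<rho> = length \<pi>"
    and "\<And>k. k < length \<pi> \<Longrightarrow> \<not> white R \<pi> k (\<pi> ! k) \<Longrightarrow> \<rho> ! k = \<pi> ! k"
  shows "white R \<rho> i v"
proof -
  from white_black_witnesses[OF assms(1)] obtain k l where
    kl: "i < k" "k < l" "(k, \<pi> ! k) \<in> black R \<pi>" "(l, \<pi> ! l) \<in> black R \<pi>"
        "v < \<pi> ! k" "v < \<pi> ! l" "R (\<pi> ! k) (\<pi> ! l)" by blast
  then have "\<rho> ! k = \<pi> ! k" "\<rho> ! l = \<pi> ! l" "l < length \<rho>"
    using assms(2,3) by (auto simp: black_def)
  with kl show ?thesis unfolding white_def
    by (intro exI[of _ k] exI[of _ l]) simp
qed

abbreviation swap :: "'a list \<Rightarrow> nat \<Rightarrow> nat \<Rightarrow> 'a list" where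
  "swap \<pi> i j \<equiv> \<pi>[i := \<pi> ! j, j := \<pi> ! i]"

text \<open>The cells of both letters, before and after the exchange, lie weakly to the lower left
  of the white cell in \<open>w\<close>. So the exchange moves no black letter, in either
  direction.\<close>

lemma white_swap:
  assumes "i < j" and w: "white R \<pi> j (max (\<pi> ! i) (\<pi> ! j))"
  shows "white R (swap \<pi> i j) = white R \<pi>"
proof -
  let ?\<rho> = "swap \<pi> i j"
  have j: "j < length \<pi>" "i < length \<pi>" using w \<open>i < j\<close> unfolding white_def by auto
  have wi: "white R \<pi> i (max (\<pi> ! i) (\<pi> ! j))" using white_mono[OF w] \<open>i < j\<close> by simp
  have oi: "white R \<pi> i (\<pi> ! i)" "white R \<pi> j (\<pi> ! j)"
    using white_mono[OF wi] white_mono[OF w] by auto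
  have 1: "white R ?\<rho> k v" if "white R \<pi> k v" for k v
    using that
  proof (rule white_if_agree_on_black)
    fix k assume "\<not> white R \<pi> k (\<pi> ! k)"
    then have "k \<noteq> i" "k \<noteq> j" using oi by blast+
    then show "?\<rho> ! k = \<pi> ! k" by simp
  qed simp
  have ni: "white R ?\<rho> i (?\<rho> ! i)" "white R ?\<rho> j (?\<rho> ! j)"
    using white_mono[OF 1[OF wi]] white_mono[OF 1[OF w]] j \<open>i < j\<close> by (auto simp: nth_list_update)
  have 2: "white R \<pi> k v" if "white R ?\<rho> k v" for k v
    using that
  proof (rule white_if_agree_on_black)
    fix k assume "\<not> white R ?\<rho> k (?\<rho> ! k)"
    then have "k \<noteq> i" "k \<noteq> j" using ni by blast+
    then show "\<pi> ! k = ?\<rho> ! k" by simp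
  qed simp
  show ?thesis using 1 2 by blast
qed

text \<open>The white region is unchanged and contains the exchanged points both before and after,
  so no black point appears or disappears.\<close>

lemma black_swap:
  assumes "i < j" and w: "white R \<pi> j (max (\<pi> ! i) (\<pi> ! j))"
  shows "black R (swap \<pi> i j) = black R \<pi>"
proof -
  have j: "j < length \<pi>" "i < length \<pi>" using assms unfolding white_def by auto
  have wi: "white R \<pi> i (max (\<pi> ! i) (\<pi> ! j))" using white_mono[OF w] \<open>i < j\<close> by simp
  have oi: "white R \<pi> i (\<pi> ! i)" "white R \<pi> j (\<pi> ! j)" "white R \<pi> i (\<pi> ! j)" "white R \<pi> j (\<pi> ! i)"
    using white_mono[OF wi] white_mono[OF w] by auto
  have "(k < length \<pi> \<and> \<not> white R \<pi> k (swap \<pi> i j ! k) \<and> x = (k, swap \<pi> i j ! k)) \<longleftrightarrow>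
        (k < length \<pi> \<and> \<not> white R \<pi> k (\<pi> ! k) \<and> x = (k, \<pi> ! k))" for k x
    using oi j by (cases "k = i"; cases "k = j") auto
  then show ?thesis
    unfolding black_def white_swap[OF assms] by (auto; metis)
qed

lemma swap_in_permutations_of_set:
  assumes "\<pi> \<in> permutations_of_set A" "i < length \<pi>" "j < length \<pi>"
  shows "swap \<pi> i j \<in> permutations_of_set A"
  using assms by (auto simp: permutations_of_set_def distinct_swap set_swap)

text \<open>
  Within a class of permutations with the same black points, a maximiser of the weight avoids
  \<open>21 \<oplus> \<tau>\<close> and a minimiser avoids \<open>12 \<oplus> \<tau>\<close>.
\<close>

definition weight :: "nat list \<Rightarrow> int" where
  "weight \<pi> = (\<Sum>k<length \<pi>. int k * int (\<pi> ! k))"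

text \<open>Only the summands at \<open>i\<close> and \<open>j\<close> change. Hence removing an
  inversion raises the weight and creating one lowers it.\<close>

lemma weight_swap:
  assumes "i < j" "j < length \<pi>"
  shows "weight (swap \<pi> i j) = weight \<pi> + (int j - int i) * (int (\<pi> ! i) - int (\<pi> ! j))"
proof -
  let ?I = "{..<length \<pi>} - {i} - {j}"
  have split: "(\<Sum>k<length \<pi>. f k) = f i + f j + (\<Sum>k\<in>?I. f k)" for f :: "nat \<Rightarrow> int"
    using assms by (simp add: sum.remove[of _ i] sum.remove[of _ j])
  have "(\<Sum>k\<in>?I. int k * int (swap \<pi> i j ! k)) = (\<Sum>k\<in>?I. int k * int (\<pi> ! k))"
    by (intro sum.cong) auto
  then show ?thesis
    using assms unfolding weight_def by (simp add: split[simplified] algebra_simps)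
qed

lemma class_has_avoider:
  assumes S: "S = (<) \<or> S = (>)" and "\<pi> \<in> permutations_of_set A" "finite A"
  shows "\<exists>\<rho> \<in> permutations_of_set A. black R \<rho> = black R \<pi> \<and> \<not> contains_sum S R \<rho>"
proof -
  let ?C = "{\<rho> \<in> permutations_of_set A. black R \<rho> = black R \<pi>}"
  \<comment> \<open>The sign makes both cases a minimisation.\<close>
  let ?w = "\<lambda>\<rho>. if S = (<) then weight \<rho> else - weight \<rho>"
  define \<rho> where "\<rho> = arg_min_on ?w ?C"
  have "finite ?C" "?C \<noteq> {}" using assms by auto
  note \<rho> = arg_min_if_finite(1)[OF this, of ?w, folded \<rho>_def]
    and min = arg_min_if_finite(2)[OF this, of ?w, folded \<rho>_def]
  have "\<not> contains_sum S R \<rho>"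
  proof
    assume "contains_sum S R \<rho>"
    then obtain i j where ij: "i < j" "S (\<rho> ! i) (\<rho> ! j)"
      and w: "white R \<rho> j (max (\<rho> ! i) (\<rho> ! j))" unfolding contains_sum_def by blast
    then have j: "j < length \<rho>" unfolding white_def by auto
    \<comment> \<open>Exchanging the first two letters of the occurrence stays in the class and
      strictly decreases \<open>?w\<close>.\<close>
    have "swap \<rho> i j \<in> ?C"
      using \<rho> ij j by (simp add: black_swap[OF ij(1) w] swap_in_permutations_of_set)
    with min have le: "?w \<rho> \<le> ?w (swap \<rho> i j)" by (meson not_less)
    show False
    proof (cases "S = (<)")
      case True
      with ij have "(int j - int i) * (int (\<rho> ! i) - int (\<rho> ! j)) < 0"
        by (intro mult_pos_neg) auto
      with le True show False by (simp add: weight_swap[OF ij(1) j])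
    next
      case False
      with ij S have "(int j - int i) * (int (\<rho> ! i) - int (\<rho> ! j)) > 0"
        by (intro mult_pos_pos) auto
      with le False show False by (simp add: weight_swap[OF ij(1) j])
    qed
  qed
  with \<rho> show ?thesis by blast
qed

text \<open>Black points are common to both words, so where the words differ both letters are white.
  The letter \<open>\<rho> ! j\<close> occurs in \<open>\<pi>\<close> before position
  \<open>j\<close> and, together with \<open>\<pi> ! j\<close>, starts the occurrence.\<close>

lemma contains_sum_if_differ:
  assumes S: "S = (<) \<or> S = (>)"
    and p: "\<pi> \<in> permutations_of_set A" and r: "\<rho> \<in> permutations_of_set A"
    and b: "black R \<pi> = black R \<rho>"
    and j: "j < length \<pi>" and later: "\<And>k. j < k \<Longrightarrow> k < length \<pi> \<Longrightarrow> \<pi> ! k = \<rho> ! k"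
    and less: "S (\<rho> ! j) (\<pi> ! j)"
  shows "contains_sum S R \<pi>"
proof -
  have W: "white R \<pi> = white R \<rho>" by (rule white_cong_black[OF b])
  have len: "length \<rho> = length \<pi>" using p r by (metis length_finite_permutations_of_set permutations_of_set_infinite empty_iff)
  have d: "distinct \<pi>" "distinct \<rho>" "set \<pi> = set \<rho>" using p r by (auto simp: permutations_of_set_def)
  have ne: "\<rho> ! j \<noteq> \<pi> ! j" using S less by auto
  have B: "(k, x) \<in> black R \<pi> \<Longrightarrow> k < length \<pi> \<and> x = \<pi> ! k \<and> x = \<rho> ! k" for k x
    using b by (auto simp: black_def)
  have wj: "white R \<pi> j (\<pi> ! j)" using B[of j "\<pi> ! j"] ne j by (auto simp: black_def)
  have wj': "white R \<pi> j (\<rho> ! j)" using B[of j "\<rho> ! j"] ne j len b W by (auto simp: black_def)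
  obtain i where i: "i < length \<pi>" "\<pi> ! i = \<rho> ! j" using d j len by (metis in_set_conv_nth)
  have "i \<noteq> j" using i ne by auto
  \<comment> \<open>Otherwise \<open>\<rho>\<close> would carry the letter \<open>\<rho> ! j\<close>
    at position \<open>i\<close> too.\<close>
  moreover have "\<not> j < i" using later[of i] i d len j by (metis nth_eq_iff_index_eq less_not_refl)
  ultimately have "i < j" by simp
  moreover have "white R \<pi> j (max (\<pi> ! i) (\<pi> ! j))" using wj wj' i by (simp add: max_def)
  ultimately show ?thesis unfolding contains_sum_def using less i(2)
    by (intro exI[of _ i] exI[of _ j]) simp
qed

lemma last_difference:
  assumes "length xs = length ys" "xs \<noteq> ys"
  obtains j where "j < length xs" "xs ! j \<noteq> ys ! j" "\<And>k. j < k \<Longrightarrow> k < length xs \<Longrightarrow> xs ! k = ys ! k"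
proof -
  let ?D = "{j. j < length xs \<and> xs ! j \<noteq> ys ! j}"
  have f: "finite ?D" "?D \<noteq> {}" using assms by (auto simp: list_eq_iff_nth_eq)
  have "Max ?D \<in> ?D" using f by (rule Max_in)
  moreover have "k \<notin> ?D" if "Max ?D < k" for k using f that Max_ge not_less by blast
  ultimately show ?thesis using that[of "Max ?D"] by blast
qed

text \<open>At the last difference \<open>S\<close> relates the two letters in one order or the
  other, which puts an occurrence into \<open>\<pi>\<close> or into \<open>\<rho>\<close>.\<close>

lemma black_inj_on_avoiders:
  assumes S: "S = (<) \<or> S = (>)"
  shows "inj_on (black R) {\<pi> \<in> permutations_of_set A. \<not> contains_sum S R \<pi>}"
proof (rule inj_onI, rule ccontr)
  fix \<pi> \<rho>
  assume a: "\<pi> \<in> {\<pi> \<in> permutations_of_set A. \<not> contains_sum S R \<pi>}"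
    "\<rho> \<in> {\<pi> \<in> permutations_of_set A. \<not> contains_sum S R \<pi>}" "black R \<pi> = black R \<rho>" "\<pi> \<noteq> \<rho>"
  then have p: "\<pi> \<in> permutations_of_set A" "\<rho> \<in> permutations_of_set A" by auto
  then have len: "length \<pi> = length \<rho>" by (metis length_finite_permutations_of_set permutations_of_set_infinite empty_iff)
  obtain j where j: "j < length \<pi>" "\<pi> ! j \<noteq> \<rho> ! j" "\<And>k. j < k \<Longrightarrow> k < length \<pi> \<Longrightarrow> \<pi> ! k = \<rho> ! k"
    using last_difference[OF len a(4)] by blast
  have "S (\<rho> ! j) (\<pi> ! j) \<or> S (\<pi> ! j) (\<rho> ! j)" using S j(2) by auto
  then show False
    using contains_sum_if_differ[OF S p a(3) j(1,3)]
      contains_sum_if_differ[OF S p(2,1) a(3)[symmetric], of j] j len a by auto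
qed

text \<open>The right-hand side does not mention \<open>S\<close>. This is what makes the counts for
  \<open>12 \<oplus> \<tau>\<close> and \<open>21 \<oplus> \<tau>\<close> equal.\<close>

lemma card_avoiders_sum:
  assumes S: "S = (<) \<or> S = (>)" and "finite A"
  shows "card {\<pi> \<in> permutations_of_set A. \<not> contains_sum S R \<pi>} = card (black R ` permutations_of_set A)"
proof -
  have "black R ` {\<pi> \<in> permutations_of_set A. \<not> contains_sum S R \<pi>} = black R ` permutations_of_set A"
  proof (intro equalityI subsetI)
    fix B assume "B \<in> black R ` permutations_of_set A"
    then obtain \<pi> where "\<pi> \<in> permutations_of_set A" "B = black R \<pi>" by blast
    with class_has_avoider[OF S this(1) \<open>finite A\<close>, of R]
    show "B \<in> black R ` {\<pi> \<in> permutations_of_set A. \<not> contains_sum S R \<pi>}"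
      by (metis (mono_tags, lifting) imageI mem_Collect_eq)
  qed blast
  then show ?thesis using card_image[OF black_inj_on_avoiders[OF S]] by metis
qed

lemma contains_sum_iff:
  "contains_sum S R \<pi> \<longleftrightarrow>
    contains_at (\<lambda>a b c d. S a b \<and> max a b < c \<and> max a b < d \<and> R c d) \<pi>"
  unfolding contains_sum_def contains_at_def white_def by blast

lemma avoiders_1234: "avoiders [1,2,3,4] n = {\<pi> \<in> permutations_of_set {1..n}. \<not> contains_sum (<) (<) \<pi>}"
  and avoiders_2134: "avoiders [2,1,3,4] n = {\<pi> \<in> permutations_of_set {1..n}. \<not> contains_sum (>) (<) \<pi>}"
  and avoiders_1243: "avoiders [1,2,4,3] n = {\<pi> \<in> permutations_of_set {1..n}. \<not> contains_sum (<) (>) \<pi>}"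
  and avoiders_2143: "avoiders [2,1,4,3] n = {\<pi> \<in> permutations_of_set {1..n}. \<not> contains_sum (>) (>) \<pi>}"
proof -
  \<comment> \<open>With the orders within the two halves fixed, the comparisons with
    \<open>max a b\<close> collapse to a single chain.\<close>
  have eq: "(\<lambda>a b c d :: nat. a < b \<and> b < c \<and> c < d) = (\<lambda>a b c d :: nat. a < b \<and> max a b < c \<and> max a b < d \<and> c < d)"
    "(\<lambda>a b c d :: nat. b < a \<and> a < c \<and> c < d) = (\<lambda>a b c d :: nat. b < a \<and> max a b < c \<and> max a b < d \<and> c < d)"
    "(\<lambda>a b c d :: nat. a < b \<and> b < d \<and> d < c) = (\<lambda>a b c d :: nat. a < b \<and> max a b < c \<and> max a b < d \<and> d < c)"
    "(\<lambda>a b c d :: nat. b < a \<and> a < d \<and> d < c) = (\<lambda>a b c d :: nat. b < a \<and> max a b < c \<and> max a b < d \<and> d < c)"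
    by (intro ext; auto)+
  show "avoiders [1,2,3,4] n = {\<pi> \<in> permutations_of_set {1..n}. \<not> contains_sum (<) (<) \<pi>}"
    "avoiders [2,1,3,4] n = {\<pi> \<in> permutations_of_set {1..n}. \<not> contains_sum (>) (<) \<pi>}"
    "avoiders [1,2,4,3] n = {\<pi> \<in> permutations_of_set {1..n}. \<not> contains_sum (<) (>) \<pi>}"
    "avoiders [2,1,4,3] n = {\<pi> \<in> permutations_of_set {1..n}. \<not> contains_sum (>) (>) \<pi>}"
    unfolding avoiders_def contains_sum_iff avoids_1234 avoids_2134 avoids_1243 avoids_2143
    unfolding eq by (rule refl)+
qed

section \<open>Reverse complement\<close>

definition rev_compl :: "nat \<Rightarrow> nat list \<Rightarrow> nat list" where
  "rev_compl n \<pi> = rev (map (\<lambda>x. n + 1 - x) \<pi>)"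

lemma rev_compl_in_permutations_of_set:
  assumes "\<pi> \<in> permutations_of_set {1..n}"
  shows "rev_compl n \<pi> \<in> permutations_of_set {1..n}"
proof -
  have "(\<lambda>x. n + 1 - x) ` {1..n} = {1..n}"
  proof (intro equalityI subsetI)
    fix x assume "x \<in> {1..n}"
    then show "x \<in> (\<lambda>x. n + 1 - x) ` {1..n}" by (intro image_eqI[of _ _ "n + 1 - x"]) auto
  qed auto
  then show ?thesis
    using assms by (auto simp: permutations_of_set_def rev_compl_def distinct_map inj_on_def)
qed

lemma rev_compl_rev_compl:
  assumes "\<pi> \<in> permutations_of_set {1..n}"
  shows "rev_compl n (rev_compl n \<pi>) = \<pi>"
proof -
  have "set \<pi> \<subseteq> {1..n}" using assms by (simp add: permutations_of_set_def)
  then have "map (\<lambda>x. n + 1 - (n + 1 - x)) \<pi> = map id \<pi>"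
    by (intro map_cong) auto
  then show ?thesis by (simp add: rev_compl_def rev_map comp_def del: diff_diff_cancel)
qed

text \<open>\<open>Q\<close> receives the complemented letters in reverse order. The bounds by
  \<open>n\<close> keep the truncated subtraction strictly decreasing.\<close>

lemma contains_at_rev_compl:
  assumes "\<pi> \<in> permutations_of_set {1..n}" "contains_at P \<pi>"
    and PQ: "\<And>a b c d. \<lbrakk>a \<le> n; b \<le> n; c \<le> n; d \<le> n; P a b c d\<rbrakk> \<Longrightarrow>
        Q (n + 1 - d) (n + 1 - c) (n + 1 - b) (n + 1 - a)"
  shows "contains_at Q (rev_compl n \<pi>)"
proof -
  have le: "k < length \<pi> \<Longrightarrow> \<pi> ! k \<le> n" for k
    using assms(1) nth_mem[of k \<pi>] by (auto simp: permutations_of_set_def)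
  from assms(2) obtain i j k l where ijkl: "i < j" "j < k" "k < l" "l < length \<pi>"
    and P: "P (\<pi> ! i) (\<pi> ! j) (\<pi> ! k) (\<pi> ! l)" unfolding contains_at_def by blast
  let ?m = "length \<pi> - 1"
  have nth: "rev_compl n \<pi> ! (?m - t) = n + 1 - \<pi> ! t" if "t < length \<pi>" for t
    using that by (simp add: rev_compl_def rev_nth)
  have "Q (n + 1 - \<pi> ! l) (n + 1 - \<pi> ! k) (n + 1 - \<pi> ! j) (n + 1 - \<pi> ! i)"
    by (intro PQ P le) (use ijkl in auto)
  then have "Q (rev_compl n \<pi> ! (?m - l)) (rev_compl n \<pi> ! (?m - k))
      (rev_compl n \<pi> ! (?m - j)) (rev_compl n \<pi> ! (?m - i))"
    using nth[of i] nth[of j] nth[of k] nth[of l] ijkl by (simp del: One_nat_def)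
  moreover have "?m - l < ?m - k" "?m - k < ?m - j" "?m - j < ?m - i" "?m - i < length (rev_compl n \<pi>)"
    using ijkl by (auto simp: rev_compl_def)
  ultimately show ?thesis unfolding contains_at_def by blast
qed

lemma card_avoiders_2134_1243: "card (avoiders [2,1,3,4] n) = card (avoiders [1,2,4,3] n)"
proof (rule bij_betw_same_card[of "rev_compl n"], rule bij_betw_byWitness[where f' = "rev_compl n"])
  have 1: "contains_at (\<lambda>a b c d. b < a \<and> a < c \<and> c < d) (rev_compl n \<pi>)"
    if "\<pi> \<in> permutations_of_set {1..n}" "contains_at (\<lambda>a b c d. a < b \<and> b < d \<and> d < c) \<pi>" for \<pi>
    by (rule contains_at_rev_compl[OF that]) auto
  have 2: "contains_at (\<lambda>a b c d. a < b \<and> b < d \<and> d < c) (rev_compl n \<pi>)"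
    if "\<pi> \<in> permutations_of_set {1..n}" "contains_at (\<lambda>a b c d. b < a \<and> a < c \<and> c < d) \<pi>" for \<pi>
    by (rule contains_at_rev_compl[OF that]) auto
  \<comment> \<open>By contraposition: applying \<open>rev_compl\<close> again carries an occurrence
    in the image back to the original.\<close>
  show "rev_compl n ` avoiders [2,1,3,4] n \<subseteq> avoiders [1,2,4,3] n"
    unfolding avoiders_def avoids_2134 avoids_1243
    using 1[OF rev_compl_in_permutations_of_set] rev_compl_in_permutations_of_set
    by (auto simp: rev_compl_rev_compl simp del: One_nat_def)
  show "rev_compl n ` avoiders [1,2,4,3] n \<subseteq> avoiders [2,1,3,4] n"
    unfolding avoiders_def avoids_2134 avoids_1243
    using 2[OF rev_compl_in_permutations_of_set] rev_compl_in_permutations_of_set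
    by (auto simp: rev_compl_rev_compl simp del: One_nat_def)
qed (auto simp: avoiders_def rev_compl_rev_compl)

theorem wilf_equivalent_1234_2143: "card (avoiders [1,2,3,4] n) = card (avoiders [2,1,4,3] n)"
proof -
  have "card (avoiders [1,2,3,4] n) = card (avoiders [2,1,3,4] n)"
    unfolding avoiders_1234 avoiders_2134 by (simp add: card_avoiders_sum)
  also have "\<dots> = card (avoiders [1,2,4,3] n)" by (rule card_avoiders_2134_1243)
  also have "\<dots> = card (avoiders [2,1,4,3] n)"
    unfolding avoiders_1243 avoiders_2143 by (simp add: card_avoiders_sum)
  finally show ?thesis .
qed

subsection \<open>The first indecomposable component\<close>

lemma length_permutation: "\<pi> \<in> permutations_of_set {1..n} \<Longrightarrow> length \<pi> = n"
  using length_finite_permutations_of_set[of \<pi> "{1..n}"] by simp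

lemma first_return_permutation:
  assumes "\<pi> \<in> permutations_of_set {1..n}" "n \<ge> 1"
  shows "1 \<le> first_return \<pi>" "first_return \<pi> \<le> n"
    and "set (take (first_return \<pi>) \<pi>) = {1..first_return \<pi>}"
proof -
  have n: "1 \<le> n \<and> set (take n \<pi>) = {1..n}"
    using assms length_permutation[OF assms(1)] by (simp add: permutations_of_set_def)
  show "1 \<le> first_return \<pi>" "set (take (first_return \<pi>) \<pi>) = {1..first_return \<pi>}"
    using LeastI[of "\<lambda>i. 1 \<le> i \<and> set (take i \<pi>) = {1..i}", OF n] by (simp_all add: first_return_def)
  show "first_return \<pi> \<le> n" 
    using Least_le[of "\<lambda>i. 1 \<le> i \<and> set (take i \<pi>) = {1..i}", OF n] by (simp add: first_return_def)
qed

text \<open>Prefixes of length at most \<open>m\<close> agree, and any longer one already exceeds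
  the first return of \<open>\<alpha>\<close>.\<close>

lemma first_return_append:
  assumes "\<alpha> \<in> permutations_of_set {1..m}" "m \<ge> 1"
  shows "first_return (\<alpha> @ \<beta>) = first_return \<alpha>"
proof -
  note r = first_return_permutation[OF assms]
  have take: "take i (\<alpha> @ \<beta>) = take i \<alpha>" if "i \<le> m" for i
    using that length_permutation[OF assms(1)] by simp
  show ?thesis unfolding first_return_def[of "\<alpha> @ \<beta>"]
  proof (rule Least_equality)
    show "1 \<le> first_return \<alpha> \<and> set (take (first_return \<alpha>) (\<alpha> @ \<beta>)) = {1..first_return \<alpha>}"
      using r by (simp only: take)
  next
    fix y assume y: "1 \<le> y \<and> set (take y (\<alpha> @ \<beta>)) = {1..y}"
    show "first_return \<alpha> \<le> y"
    proof (cases "y \<le> m")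
      case True
      with y show ?thesis unfolding first_return_def by (intro Least_le) (simp only: take)
    qed (use r in simp)
  qed
qed

lemma split_at_first_return:
  assumes "\<pi> \<in> permutations_of_set {1..n}" "n \<ge> 1" "first_return \<pi> = m"
  shows "take m \<pi> \<in> permutations_of_set {1..m}" "indecomposable (take m \<pi>)"
    and "set (drop m \<pi>) = {m + 1..n}" "distinct (drop m \<pi>)"
proof -
  note r = first_return_permutation[OF assms(1,2), unfolded assms(3)]
  have d: "distinct \<pi>" "set \<pi> = {1..n}" using assms(1) by (auto simp: permutations_of_set_def)
  show p: "take m \<pi> \<in> permutations_of_set {1..m}"
    using r d by (simp add: permutations_of_set_def)
  have "first_return (take m \<pi>) = m"
    using first_return_append[OF p r(1), of "drop m \<pi>"] assms(3) by simp
  then show "indecomposable (take m \<pi>)"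
    using r(1) length_permutation[OF p] by (auto simp: indecomposable_def)
  show "distinct (drop m \<pi>)" using d by simp
  have "set (take m \<pi>) \<union> set (drop m \<pi>) = {1..n}"
    by (metis append_take_drop_id d(2) set_append)
  moreover have "set (take m \<pi>) \<inter> set (drop m \<pi>) = {}"
    using set_take_disj_set_drop_if_distinct[OF d(1)] by simp
  ultimately have "set (drop m \<pi>) = {1..n} - set (take m \<pi>)" by blast
  then show "set (drop m \<pi>) = {m + 1..n}" unfolding r(3) by auto
qed

lemma first_return_eq_iff_indecomposable:
  assumes "\<pi> \<in> permutations_of_set {1..n}" "n \<ge> 1"
  shows "first_return \<pi> = n \<longleftrightarrow> indecomposable \<pi>"
  using assms length_permutation[OF assms(1)] by (auto simp: indecomposable_def)

lemma indec_avoiders_eq: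
  "n \<ge> 1 \<Longrightarrow> indec_avoiders \<sigma> n = {\<pi> \<in> avoiders \<sigma> n. first_return \<pi> = n}"
  unfolding indec_avoiders_def avoiders_def using first_return_eq_iff_indecomposable by blast

section \<open>Occurrences of 2143 and descents when a leading 1 or an increasing tail is
  added\<close>

lemma avoids_2143_Cons_Suc:
  assumes "\<beta> \<in> permutations_of_set {1..n}"
  shows "avoids (1 # map Suc \<beta>) [2,1,4,3] \<longleftrightarrow> avoids \<beta> [2,1,4,3]"
proof -
  have "contains_at (\<lambda>a b c d. b < a \<and> a < d \<and> d < c) (1 # map Suc \<beta>) \<longleftrightarrow>
        contains_at (\<lambda>a b c d. b < a \<and> a < d \<and> d < c) \<beta>" (is "?L \<longleftrightarrow> ?R")
  proof
    assume ?L
    then obtain i j k l where ijkl: "i < j" "j < k" "k < l" "l < length (1 # map Suc \<beta>)"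
      and P: "(1 # map Suc \<beta>) ! j < (1 # map Suc \<beta>) ! i" "(1 # map Suc \<beta>) ! i < (1 # map Suc \<beta>) ! l"
        "(1 # map Suc \<beta>) ! l < (1 # map Suc \<beta>) ! k"
      unfolding contains_at_def by blast
    obtain j' k' l' where jkl: "j = Suc j'" "k = Suc k'" "l = Suc l'"
      using ijkl by (metis less_imp_Suc_add)
    \<comment> \<open>The first letter of an occurrence exceeds the second, so it cannot be the
      leading 1.\<close>
    have "i \<noteq> 0" using P(1) ijkl jkl by (intro notI) simp
    then obtain i' where "i = Suc i'" by (metis not0_implies_Suc)
    with P ijkl jkl show ?R unfolding contains_at_def
      by (intro exI[of _ i'] exI[of _ j'] exI[of _ k'] exI[of _ l']) simp
  next
    assume ?R
    then obtain i j k l where "i < j" "j < k" "k < l" "l < length \<beta>"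
      "\<beta> ! j < \<beta> ! i" "\<beta> ! i < \<beta> ! l" "\<beta> ! l < \<beta> ! k" unfolding contains_at_def by blast
    then show ?L unfolding contains_at_def
      by (intro exI[of _ "Suc i"] exI[of _ "Suc j"] exI[of _ "Suc k"] exI[of _ "Suc l"]) simp
  qed
  then show ?thesis by (simp only: avoids_2143)
qed

text \<open>The appended letters are fixed points; the offset 1 comes from positions starting at
  0.\<close>

lemma nth_append_upt:
  assumes "\<alpha> \<in> permutations_of_set {1..m}" "m \<le> k" "k < n"
  shows "(\<alpha> @ [m + 1..<n + 1]) ! k = k + 1"
  using assms length_permutation[OF assms(1)] by (simp add: nth_append del: upt_Suc)

lemma nth_append_le:
  assumes "\<alpha> \<in> permutations_of_set {1..m}" "k < m"
  shows "(\<alpha> @ \<beta>) ! k = \<alpha> ! k" "\<alpha> ! k \<le> m"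
  using assms length_permutation[OF assms(1)] nth_mem[of k \<alpha>]
  by (auto simp: nth_append permutations_of_set_def)

text \<open>The last letter of a 2143 is smaller than the one before it, whereas an appended letter
  exceeds all earlier ones. So every occurrence ends inside \<open>\<alpha>\<close>.\<close>

lemma avoids_2143_append_upt:
  assumes \<alpha>: "\<alpha> \<in> permutations_of_set {1..m}" and "m \<le> n"
  shows "avoids (\<alpha> @ [m + 1..<n + 1]) [2,1,4,3] \<longleftrightarrow> avoids \<alpha> [2,1,4,3]"
proof -
  let ?\<pi> = "\<alpha> @ [m + 1..<n + 1]"
  have len: "length \<alpha> = m" "length ?\<pi> = n" using length_permutation[OF \<alpha>] \<open>m \<le> n\<close> by simp_all
  have "contains_at (\<lambda>a b c d. b < a \<and> a < d \<and> d < c) ?\<pi> \<longleftrightarrow>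
        contains_at (\<lambda>a b c d. b < a \<and> a < d \<and> d < c) \<alpha>" (is "?L \<longleftrightarrow> ?R")
  proof
    assume ?L
    then obtain i j k l where ijkl: "i < j" "j < k" "k < l" "l < length ?\<pi>"
      and P: "?\<pi> ! j < ?\<pi> ! i" "?\<pi> ! i < ?\<pi> ! l" "?\<pi> ! l < ?\<pi> ! k"
      unfolding contains_at_def by blast
    have "l < m"
    proof (rule ccontr)
      assume "\<not> l < m"
      then have "?\<pi> ! l = l + 1" using nth_append_upt[OF \<alpha>] ijkl(4) len by simp
      moreover have "?\<pi> ! k \<le> l"
      proof (cases "k < m")
        case True
        then show ?thesis using nth_append_le[OF \<alpha> True] \<open>\<not> l < m\<close> by simp
      next
        case False
        then show ?thesis using nth_append_upt[OF \<alpha>, of k n] ijkl len by simp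
      qed
      ultimately show False using P(3) by simp
    qed
    with P ijkl show ?R unfolding contains_at_def len
      by (intro exI[of _ i] exI[of _ j] exI[of _ k] exI[of _ l]) (simp add: nth_append len del: upt_Suc)
  next
    assume ?R
    then obtain i j k l where "i < j" "j < k" "k < l" "l < length \<alpha>"
      "\<alpha> ! j < \<alpha> ! i" "\<alpha> ! i < \<alpha> ! l" "\<alpha> ! l < \<alpha> ! k" unfolding contains_at_def by blast
    then show ?L unfolding contains_at_def
      by (intro exI[of _ i] exI[of _ j] exI[of _ k] exI[of _ l]) (simp add: nth_append del: upt_Suc)
  qed
  then show ?thesis by (simp only: avoids_2143)
qed

text \<open>The leading 1 starts no descent; all others shift by one position.\<close>

lemma card_descents_Cons_Suc: "card (descents (1 # map Suc \<beta>)) = card (descents \<beta>)"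
proof -
  have "descents (1 # map Suc \<beta>) = Suc ` descents \<beta>"
  proof (rule set_eqI)
    fix i show "i \<in> descents (1 # map Suc \<beta>) \<longleftrightarrow> i \<in> Suc ` descents \<beta>"
      by (cases i; cases "\<beta> = []") (auto simp: descents_def nth_map)
  qed
  then show ?thesis by (simp add: card_image)
qed

lemma descents_append_upt:
  assumes \<alpha>: "\<alpha> \<in> permutations_of_set {1..m}" and "m \<le> n"
  shows "descents (\<alpha> @ [m + 1..<n + 1]) = descents \<alpha>"
proof -
  let ?\<pi> = "\<alpha> @ [m + 1..<n + 1]"
  have len: "length \<alpha> = m" "length ?\<pi> = n" using length_permutation[OF \<alpha>] \<open>m \<le> n\<close> by simp_all
  \<comment> \<open>This covers the junction \<open>Suc i = m\<close> as well as the appended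
    run.\<close>
  have "?\<pi> ! i < ?\<pi> ! Suc i" if "m \<le> Suc i" "Suc i < n" for i
  proof (cases "i < m")
    case True
    then show ?thesis using nth_append_le[OF \<alpha> True] nth_append_upt[OF \<alpha> that] that by simp
  next
    case False
    then show ?thesis using nth_append_upt[OF \<alpha>, of i n] nth_append_upt[OF \<alpha> that] that by simp
  qed
  then have "Suc i < m" if "Suc i < n" "?\<pi> ! i > ?\<pi> ! Suc i" for i
    using that by (meson less_asym not_less)
  then have "Suc i < n \<and> ?\<pi> ! i > ?\<pi> ! Suc i \<longleftrightarrow> Suc i < m \<and> ?\<pi> ! i > ?\<pi> ! Suc i" for i
    using \<open>m \<le> n\<close> by (meson less_le_trans)
  moreover have "Suc i < m \<and> ?\<pi> ! i > ?\<pi> ! Suc i \<longleftrightarrow> Suc i < m \<and> \<alpha> ! i > \<alpha> ! Suc i" for i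
    using nth_append_le(1)[OF \<alpha>] by auto
  ultimately show ?thesis unfolding descents_def len by simp
qed

lemma sorted_eq_upt:
  assumes "sorted xs" "distinct xs" "set xs = {a..n}"
  shows "xs = [a..<n + 1]"
proof (rule sorted_distinct_set_unique[OF assms(1,2)])
  show "set xs = set [a..<n + 1]" by (simp only: assms(3) set_upt) auto
qed (rule sorted_upt distinct_upt)+

text \<open>The first component contains a 21, and an inversion among the later, larger letters
  would complete it to 2143.\<close>

lemma drop_first_return_2143:
  assumes \<pi>: "\<pi> \<in> avoiders [2,1,4,3] n" and m: "first_return \<pi> = m" "2 \<le> m" "m < n"
  shows "drop m \<pi> = [m + 1..<n + 1]"
proof -
  have p: "\<pi> \<in> permutations_of_set {1..n}" and n: "n \<ge> 1" using \<pi> m by (auto simp: avoiders_def)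
  note s = split_at_first_return[OF p n m(1)]
  have len: "length \<pi> = n" by (rule length_permutation[OF p])
  \<comment> \<open>A sorted component would begin with 1 and so return at 1 already.\<close>
  have "\<not> sorted (take m \<pi>)"
  proof
    assume "sorted (take m \<pi>)"
    then have upt: "take m \<pi> = [1..<m + 1]"
      using s(1) by (intro sorted_eq_upt) (simp_all add: permutations_of_set_def)
    have "take 1 \<pi> = take 1 (take m \<pi>)" using m(2) by simp
    also have "\<dots> = [1]" using m(2) unfolding upt by (subst upt_conv_Cons) simp_all
    finally have "take 1 \<pi> = [1]" .
    then have "first_return \<pi> \<le> 1"
      unfolding first_return_def by (intro Least_le) (simp del: One_nat_def)
    with m show False by simp
  qed
  then obtain i j where ij: "i < j" "j < m" "\<pi> ! j < \<pi> ! i"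
    using len m(3) unfolding sorted_iff_nth_mono_less by (auto simp: not_le)
  have small: "\<pi> ! i \<le> m"
    using nth_append_le(2)[OF s(1), of i] ij by simp
  have "sorted (drop m \<pi>)"
    unfolding sorted_iff_nth_mono_less
  proof (intro allI impI, rule ccontr)
    fix a b assume ab: "a < b" "b < length (drop m \<pi>)" "\<not> drop m \<pi> ! a \<le> drop m \<pi> ! b"
    have "drop m \<pi> ! b \<in> {m + 1..n}" using nth_mem[OF ab(2)] s(3) by simp
    then have "contains_at (\<lambda>a b c d. b < a \<and> a < d \<and> d < c) \<pi>"
      unfolding contains_at_def using ab ij small len m
      by (intro exI[of _ i] exI[of _ j] exI[of _ "m + a"] exI[of _ "m + b"]) auto
    with \<pi> show False by (simp add: avoiders_def avoids_2143 del: One_nat_def)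
  qed
  then show ?thesis using s(3,4) by (intro sorted_eq_upt)
qed

lemma avoiders_2143_first_return_1:
  assumes "n \<ge> 2"
  shows "{\<pi> \<in> avoiders [2,1,4,3] n. first_return \<pi> = 1} =
         (\<lambda>\<beta>. 1 # map Suc \<beta>) ` avoiders [2,1,4,3] (n - 1)" (is "?L = ?f ` ?R")
proof (intro equalityI subsetI)
  fix \<pi> assume "\<pi> \<in> ?L"
  then have \<pi>: "\<pi> \<in> permutations_of_set {1..n}" "avoids \<pi> [2,1,4,3]" "first_return \<pi> = 1"
    by (auto simp: avoiders_def)
  have n: "n \<ge> 1" using assms by simp
  note s = split_at_first_return[OF \<pi>(1) n \<pi>(3)]
  define \<beta> where "\<beta> = map (\<lambda>x. x - 1) (drop 1 \<pi>)"
  \<comment> \<open>The letters after the first are at least 2, so \<open>Suc\<close> undoes the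
    truncated predecessor.\<close>
  have "map Suc \<beta> = map id (drop 1 \<pi>)"
    unfolding \<beta>_def map_map using s(3) by (intro map_cong) auto
  moreover have "take 1 \<pi> = [1]" using s(1) by (simp add: permutations_of_set_singleton)
  ultimately have eq: "\<pi> = 1 # map Suc \<beta>"
    using append_take_drop_id[of 1 \<pi>] by simp
  have "set \<beta> = {1..n - 1}"
  proof -
    have "Suc ` set \<beta> = {2..n}"
      using s(3) arg_cong[OF \<open>map Suc \<beta> = map id (drop 1 \<pi>)\<close>, of set] by (simp add: numeral_2_eq_2)
    also have "\<dots> = Suc ` {1..n - 1}" using n by (simp add: numeral_2_eq_2)
    finally show ?thesis by (simp only: inj_image_eq_iff[OF inj_Suc])
  qed
  moreover have "distinct \<beta>" using \<pi>(1) unfolding eq by (auto simp: permutations_of_set_def distinct_map)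
  ultimately have \<beta>: "\<beta> \<in> permutations_of_set {1..n - 1}" by (simp add: permutations_of_set_def)
  then have "\<beta> \<in> ?R" using \<pi>(2) avoids_2143_Cons_Suc[OF \<beta>] unfolding eq by (simp add: avoiders_def)
  then show "\<pi> \<in> ?f ` ?R" using eq by blast
next
  fix \<pi> assume "\<pi> \<in> ?f ` ?R"
  then obtain \<beta> where \<beta>: "\<beta> \<in> permutations_of_set {1..n - 1}" "avoids \<beta> [2,1,4,3]"
    and eq: "\<pi> = 1 # map Suc \<beta>" by (auto simp: avoiders_def)
  have "set \<pi> = insert 1 (Suc ` {1..n - 1})"
    using \<beta>(1) by (simp add: eq permutations_of_set_def)
  also have "\<dots> = {1..n}" by (simp only: image_Suc_atLeastAtMost) (use assms in auto)
  finally have "\<pi> \<in> permutations_of_set {1..n}"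
    using \<beta>(1) by (auto simp: eq permutations_of_set_def distinct_map)
  moreover have "first_return \<pi> = 1"
    unfolding first_return_def by (rule Least_equality) (auto simp: eq)
  ultimately show "\<pi> \<in> ?L" using \<beta>(2) avoids_2143_Cons_Suc[OF \<beta>(1)] by (simp add: avoiders_def eq)
qed

text \<open>The rest after the first component is forced to be increasing, so the component
  determines the permutation.\<close>

lemma avoiders_2143_first_return_between:
  assumes m: "2 \<le> m" "m < n"
  shows "{\<pi> \<in> avoiders [2,1,4,3] n. first_return \<pi> = m} =
         (\<lambda>\<alpha>. \<alpha> @ [m + 1..<n + 1]) ` indec_avoiders [2,1,4,3] m" (is "?L = ?f ` ?R")
proof (intro equalityI subsetI)
  fix \<pi> assume "\<pi> \<in> ?L"
  then have a: "\<pi> \<in> avoiders [2,1,4,3] n" and fr: "first_return \<pi> = m" by auto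
  have p: "\<pi> \<in> permutations_of_set {1..n}" "avoids \<pi> [2,1,4,3]" and n: "n \<ge> 1"
    using a m by (auto simp: avoiders_def)
  note s = split_at_first_return[OF p(1) n fr]
  have eq: "\<pi> = take m \<pi> @ [m + 1..<n + 1]"
    using drop_first_return_2143[OF a fr m] by (metis append_take_drop_id)
  have "avoids (take m \<pi>) [2,1,4,3]"
    using avoids_2143_append_upt[OF s(1), of n] p(2) m eq by simp
  then have "take m \<pi> \<in> ?R" using s by (simp add: indec_avoiders_def avoiders_def)
  then show "\<pi> \<in> ?f ` ?R" using eq by blast
next
  fix \<pi> assume "\<pi> \<in> ?f ` ?R"
  then obtain \<alpha> where \<alpha>: "\<alpha> \<in> permutations_of_set {1..m}" "avoids \<alpha> [2,1,4,3]" "indecomposable \<alpha>"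
    and eq: "\<pi> = \<alpha> @ [m + 1..<n + 1]" by (auto simp: indec_avoiders_def avoiders_def simp del: upt_Suc)
  have "first_return \<pi> = m"
    using first_return_append[OF \<alpha>(1)] first_return_eq_iff_indecomposable[OF \<alpha>(1)] \<alpha>(3) m
    by (simp add: eq del: upt_Suc)
  moreover have "\<pi> \<in> permutations_of_set {1..n}"
  proof (rule permutations_of_setI)
    have "set \<pi> = {1..m} \<union> {m + 1..<n + 1}"
      using \<alpha>(1) by (simp only: eq set_append set_upt permutations_of_setD)
    also have "\<dots> = {1..n}" using m by auto
    finally show "set \<pi> = {1..n}" .
    show "distinct \<pi>"
      using \<alpha>(1) by (auto simp: eq permutations_of_set_def simp del: upt_Suc)
  qed
  ultimately show "\<pi> \<in> ?L"
    using \<alpha>(2) avoids_2143_append_upt[OF \<alpha>(1), of n] m by (simp add: avoiders_def eq del: upt_Suc)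
qed

section \<open>Counting by the first return\<close>

lemma card_image_filter:
  assumes "inj_on f S" "\<And>x. x \<in> S \<Longrightarrow> Q (f x) = P x"
  shows "card {y \<in> f ` S. Q y} = card {x \<in> S. P x}"
proof -
  have "{y \<in> f ` S. Q y} = f ` {x \<in> S. P x}" using assms(2) by auto
  then show ?thesis using assms(1) by (simp add: card_image inj_on_subset)
qed

lemma finite_avoiders: "finite (avoiders \<sigma> n)"
  by (simp add: avoiders_def)

text \<open>Separates first return \<open>n\<close> (indecomposable) and 1 (arbitrary rest) from the
  lengths between. For \<open>n = 1\<close> the two ends coincide and are counted once.\<close>

lemma sum_split_ends:
  fixes c :: "nat \<Rightarrow> nat"
  assumes "n \<ge> 1"
  shows "sum c {1..n} = c n + ((if n \<ge> 2 then c 1 else 0) + sum c {2..<n})"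
proof (cases "n = 1")
  case False
  then have n: "1 < n" using assms by simp
  have "sum c {1..n} = c n + sum c {1..<n}" by (rule sum.last_plus[OF assms])
  also have "sum c {1..<n} = c 1 + sum c {2..<n}"
    using sum.atLeast_Suc_lessThan[OF n, of c] by (simp add: numeral_2_eq_2)
  finally show ?thesis using n by simp
qed simp

text \<open>The predicate \<open>P\<close> serves two purposes: equality with \<open>i\<close> gives
  the refined count, a constantly true \<open>P\<close> the total.\<close>

lemma card_avoiders_2143_by_descents:
  assumes "n \<ge> 1"
  shows "card {\<pi> \<in> avoiders [2,1,4,3] n. P (card (descents \<pi>))} =
    card {\<pi> \<in> indec_avoiders [2,1,4,3] n. P (card (descents \<pi>))} +
    (if n \<ge> 2 then card {\<pi> \<in> avoiders [2,1,4,3] (n - 1). P (card (descents \<pi>))} else 0) +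
    (\<Sum>m\<in>{2..<n}. card {\<pi> \<in> indec_avoiders [2,1,4,3] m. P (card (descents \<pi>))})"
proof -
  let ?S = "{\<pi> \<in> avoiders [2,1,4,3] n. P (card (descents \<pi>))}"
  let ?F = "\<lambda>m. {\<pi> \<in> avoiders [2,1,4,3] n. first_return \<pi> = m}"
  let ?c = "\<lambda>m. card {\<pi> \<in> ?F m. P (card (descents \<pi>))}"
  have "first_return ` ?S \<subseteq> {1..n}"
    using first_return_permutation[OF _ assms] by (auto simp: avoiders_def)
  then have "card ?S = (\<Sum>m\<in>{1..n}. card {\<pi> \<in> ?S. first_return \<pi> = m})"
    using sum.group[of ?S "{1..n}" first_return "\<lambda>_. 1::nat"] finite_avoiders by simp
  also have "\<dots> = (\<Sum>m\<in>{1..n}. ?c m)"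
    by (intro sum.cong refl arg_cong[where f = card]) auto
  also have "\<dots> = ?c n + ((if n \<ge> 2 then ?c 1 else 0) + (\<Sum>m\<in>{2..<n}. ?c m))"
    by (rule sum_split_ends[OF assms])
  also have "?c n = card {\<pi> \<in> indec_avoiders [2,1,4,3] n. P (card (descents \<pi>))}"
    by (simp only: indec_avoiders_eq[OF assms])
  also have "(if n \<ge> 2 then ?c 1 else 0) =
      (if n \<ge> 2 then card {\<pi> \<in> avoiders [2,1,4,3] (n - 1). P (card (descents \<pi>))} else 0)"
  proof (intro if_cong refl)
    assume "n \<ge> 2"
    show "?c 1 = card {\<pi> \<in> avoiders [2,1,4,3] (n - 1). P (card (descents \<pi>))}"
      unfolding avoiders_2143_first_return_1[OF \<open>n \<ge> 2\<close>]
      by (rule card_image_filter) (simp_all add: card_descents_Cons_Suc[simplified] inj_on_def)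
  qed
  also have "(\<Sum>m\<in>{2..<n}. ?c m) =
      (\<Sum>m\<in>{2..<n}. card {\<pi> \<in> indec_avoiders [2,1,4,3] m. P (card (descents \<pi>))})"
  proof (intro sum.cong refl)
    fix m assume "m \<in> {2..<n}"
    then have m: "2 \<le> m" "m < n" by auto
    show "?c m = card {\<pi> \<in> indec_avoiders [2,1,4,3] m. P (card (descents \<pi>))}"
      unfolding avoiders_2143_first_return_between[OF m]
      using m by (intro card_image_filter)
        (simp_all add: inj_on_def indec_avoiders_def avoiders_def descents_append_upt del: upt_Suc One_nat_def)
  qed
  finally show ?thesis by (simp only: add.assoc)
qed

lemma A_count_2143:
  assumes "n \<ge> 1"
  shows "A_count [2,1,4,3] n i = I_count [2,1,4,3] n i +
    (if n \<ge> 2 then A_count [2,1,4,3] (n - 1) i else 0) + (\<Sum>m\<in>{2..<n}. I_count [2,1,4,3] m i)"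
  unfolding A_count_def I_count_def by (rule card_avoiders_2143_by_descents[OF assms])

lemma card_avoiders_2143:
  assumes "n \<ge> 1"
  shows "card (avoiders [2,1,4,3] n) = I_total [2,1,4,3] n +
    (if n \<ge> 2 then card (avoiders [2,1,4,3] (n - 1)) else 0) + (\<Sum>m\<in>{2..<n}. I_total [2,1,4,3] m)"
  using card_avoiders_2143_by_descents[OF assms, of "\<lambda>_. True"] by (simp add: I_total_def)

lemma avoiders_trivial:
  assumes "n < length \<sigma>"
  shows "avoiders \<sigma> n = permutations_of_set {1..n}"
proof -
  have "avoids \<pi> \<sigma>" if "\<pi> \<in> permutations_of_set {1..n}" for \<pi>
    using assms length_permutation[OF that]
    by (auto simp: avoids_def order_isomorphic_def dest!: list_emb_length)
  then show ?thesis by (auto simp: avoiders_def)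
qed

lemma indec_avoiders_1:
  assumes "1 < length \<sigma>"
  shows "indec_avoiders \<sigma> 1 = {[1]}"
proof -
  have "first_return [1] = 1"
    using first_return_permutation[of "[1]" 1] by (simp add: permutations_of_set_def)
  then show ?thesis
    using assms by (auto simp: indec_avoiders_def avoiders_trivial indecomposable_def permutations_of_set_singleton)
qed

lemma I_count_1: "1 < length \<sigma> \<Longrightarrow> I_count \<sigma> 1 i = (if i = 0 then 1 else 0)"
proof -
  assume "1 < length \<sigma>"
  then have "I_count \<sigma> 1 i = card {\<pi>. \<pi> = [1] \<and> card (descents \<pi>) = i}"
    by (simp add: I_count_def indec_avoiders_1 del: One_nat_def)
  moreover have "{\<pi>. \<pi> = [1] \<and> card (descents \<pi>) = i} = (if i = 0 then {[1]} else {})"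
    by (auto simp: descents_def)
  ultimately show ?thesis by simp
qed

lemma I_total_1: "1 < length \<sigma> \<Longrightarrow> I_total \<sigma> 1 = 1"
  by (simp add: I_total_def indec_avoiders_1 del: One_nat_def)

lemma E_count_0: "E_count 0 = 1" and E_count_1: "E_count 1 = 1"
  by (simp_all add: E_count_def avoiders_trivial)

lemma E_count_rec:
  assumes "n \<ge> 1"
  shows "E_count n = I_total [2,1,4,3] n + (if n \<ge> 2 then E_count (n - 1) else 0) +
    (\<Sum>m\<in>{2..<n}. I_total [2,1,4,3] m)"
  using card_avoiders_2143[OF assms] by (simp only: E_count_def wilf_equivalent_1234_2143)

text \<open>Subtract the recurrence for \<open>n - 1\<close> from the one for \<open>n\<close>: the
  summand for \<open>n - 1\<close> gained by the sum cancels against the leading term of the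
  former.\<close>

lemma I_total_2143:
  assumes "n \<ge> 2"
  shows "int (I_total [2,1,4,3] n) = int (E_count n) - 2 * int (E_count (n - 1)) + int (E_count (n - 2))"
\<comment> \<open>Here the recurrence for \<open>n - 1 = 1\<close> has no \<open>E_count\<close>
  term on the right; the values at 0 and 1 settle the case directly.\<close>
proof (cases "n = 2")
  case True
  have "E_count 2 = I_total [2,1,4,3] 2 + E_count 1"
    by (subst E_count_rec) simp_all
  then show ?thesis unfolding True using E_count_0 E_count_1 by simp
next
  case False
  with assms obtain k where k: "n = k + 2" "k \<ge> 1"
    by (intro that[of "n - 2"]) auto
  have "E_count (k + 2) = I_total [2,1,4,3] (k + 2) + E_count (k + 1)
      + (\<Sum>m\<in>{2..<k + 2}. I_total [2,1,4,3] m)"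
    by (subst E_count_rec) simp_all
  moreover have "E_count (k + 1) = I_total [2,1,4,3] (k + 1) + E_count k
      + (\<Sum>m\<in>{2..<k + 1}. I_total [2,1,4,3] m)"
    using k(2) by (subst E_count_rec) simp_all
  moreover have "(\<Sum>m\<in>{2..<k + 2}. I_total [2,1,4,3] m) =
      (\<Sum>m\<in>{2..<k + 1}. I_total [2,1,4,3] m) + I_total [2,1,4,3] (k + 1)"
    using k(2) sum.atLeastLessThan_Suc[of 2 "k + 1" "I_total [2,1,4,3]"] by simp
  moreover have "n - 1 = k + 1" "n - 2 = k" using k by simp_all
  ultimately show ?thesis unfolding k(1) by simp
qed

subsection \<open>Generating functions\<close>

unbundle fps_syntax

lemma E_gf_nth: "E_gf $ n = of_nat (E_count n)"
  by (simp add: E_gf_def)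

lemma A_gf_nth_0: "A_gf \<sigma> $ 0 = 1"
  and A_gf_nth: "n \<ge> 1 \<Longrightarrow> A_gf \<sigma> $ n $ i = of_nat (A_count \<sigma> n i)"
  by (simp_all add: A_gf_def)

lemma I_gf_nth_0: "I_gf \<sigma> $ 0 = 0"
  and I_gf_nth: "n \<ge> 1 \<Longrightarrow> I_gf \<sigma> $ n $ i = of_nat (I_count \<sigma> n i)"
  by (simp_all add: I_gf_def)

text \<open>The factor \<open>(1 - fps_X)\<^sup>2\<close> takes second differences, which gives the
  coefficients from 2 on. The terms \<open>2 * fps_X - 1\<close> correct the first two:
  \<open>E_0 - 1 = 0\<close> and \<open>E_1 - 2 E_0 + 2 = 1\<close>.\<close>

lemma I_gf1_2143: "I_gf1 [2,1,4,3] = (1 - fps_X)\<^sup>2 * E_gf + 2 * fps_X - 1"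
proof (rule fps_ext)
  fix n
  let ?X = "fps_X :: rat fps"
  have "(1 - ?X)\<^sup>2 * E_gf + 2 * ?X - 1 = E_gf - ?X * E_gf - ?X * E_gf + ?X * (?X * E_gf) + ?X + ?X - 1"
    by (simp add: power2_eq_square algebra_simps)
  then have expand: "((1 - ?X)\<^sup>2 * E_gf + 2 * ?X - 1) $ n =
      E_gf $ n - (?X * E_gf) $ n - (?X * E_gf) $ n + (?X * (?X * E_gf)) $ n + ?X $ n + ?X $ n - 1 $ n"
    by (simp only: fps_add_nth fps_sub_nth)
  have lhs: "I_gf1 [2,1,4,3] $ n = of_nat (I_total [2,1,4,3] n)"
    unfolding I_gf1_eq fps_nth_Abs_fps ..
  consider "n = 0" | "n = 1" | k where "n = Suc (Suc k)" by (metis One_nat_def not0_implies_Suc)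
  then show "I_gf1 [2,1,4,3] $ n = ((1 - ?X)\<^sup>2 * E_gf + 2 * ?X - 1) $ n"
  proof cases
    case 1
    then show ?thesis unfolding lhs expand
      by (simp add: E_gf_nth E_count_0 I_total_def indec_avoiders_0)
  next
    case 2
    have "I_total [2,1,4,3] 1 = 1" by (rule I_total_1) simp
    then show ?thesis unfolding lhs expand unfolding 2
      using E_count_0 E_count_1 by (simp add: E_gf_nth)
  next
    case 3
    have "rat_of_int (int (I_total [2,1,4,3] n)) =
        rat_of_int (int (E_count n) - 2 * int (E_count (n - 1)) + int (E_count (n - 2)))"
      using 3 by (subst I_total_2143) simp_all
    then show ?thesis unfolding lhs expand unfolding 3
      by (simp add: E_gf_nth)
  qed
qed

text \<open>Division by \<open>1 - fps_X\<close> forms partial sums; the factor \<open>fps_X\<close>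
  makes the bound strict.\<close>

lemma fps_X_div_one_minus_fps_X_mult_nth:
  fixes F :: "rat fps fps"
  shows "(fps_X / (1 - fps_X) * F) $ n = (\<Sum>m<n. F $ m)"
proof -
  have eq: "fps_X / (1 - fps_X) * F = fps_X * (F * Abs_fps (\<lambda>n. 1))"
    unfolding fps_X_div_one_minus_fps_X by (simp only: mult_ac)
  show ?thesis
  proof (cases n)
    case (Suc k)
    have "(fps_X * (F * Abs_fps (\<lambda>n. 1))) $ n = (F * Abs_fps (\<lambda>n. 1)) $ k"
      by (simp add: Suc)
    then show ?thesis
      unfolding eq by (simp add: Suc fps_mult_nth atMost_atLeast0 lessThan_Suc_atMost)
  qed (simp add: eq)
qed

lemma A_gf_2143:
  "A_gf [2,1,4,3] = 1 + I_gf [2,1,4,3] + fps_X * (A_gf [2,1,4,3] - 1)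
     + fps_X / (1 - fps_X) * (I_gf [2,1,4,3] - fps_X)"
proof (rule fps_ext, rule fps_ext)
  fix n i
  define \<sigma> where "\<sigma> = [2, 1, 4, 3 :: nat]"
  \<comment> \<open>Removes the component 1, whose arbitrary rest is counted by
    \<open>fps_X * (A_gf \<sigma> - 1)\<close>.\<close>
  define J where "J = I_gf \<sigma> - fps_X"
  have J: "J $ m $ i = (if m \<ge> 2 then of_nat (I_count \<sigma> m i) else 0)" for m
  proof -
    have 1: "I_count \<sigma> 1 i = (if i = 0 then 1 else 0)" by (rule I_count_1) (simp add: \<sigma>_def)
    consider "m = 0" | "m = 1" | "m \<ge> 2" by linarith
    then show ?thesis
      by cases (use 1 in \<open>simp_all add: J_def I_gf_nth_0 I_gf_nth fps_X_nth\<close>)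
  qed
  have last: "(fps_X / (1 - fps_X) * J) $ n $ i = of_nat (\<Sum>m\<in>{2..<n}. I_count \<sigma> m i)"
    unfolding fps_X_div_one_minus_fps_X_mult_nth fps_sum_nth J of_nat_sum
    by (intro sum.mono_neutral_cong_right) auto
  have "A_gf \<sigma> $ n $ i = (1 + I_gf \<sigma> + fps_X * (A_gf \<sigma> - 1) + fps_X / (1 - fps_X) * J) $ n $ i"
  proof (cases "n = 0")
    case True
    then show ?thesis unfolding fps_add_nth last by (simp add: A_gf_nth_0 I_gf_nth_0)
  next
    case False
    then have n: "n \<ge> 1" by simp
    \<comment> \<open>Subtracting the constant term 1 gives 0 at \<open>n = 1\<close>, where the
      permutation 1 is already counted as indecomposable.\<close>
    have "(fps_X * (A_gf \<sigma> - 1)) $ n $ i = (if n \<ge> 2 then of_nat (A_count \<sigma> (n - 1) i) else 0)"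
      using False by (cases "n = 1") (simp_all add: A_gf_nth_0 A_gf_nth)
    then show ?thesis
      unfolding fps_add_nth last A_gf_nth[OF n] I_gf_nth[OF n] A_count_2143[OF n, folded \<sigma>_def]
      using False by simp
  qed
  then show "A_gf [2,1,4,3] $ n $ i = (1 + I_gf [2,1,4,3] + fps_X * (A_gf [2,1,4,3] - 1)
     + fps_X / (1 - fps_X) * (I_gf [2,1,4,3] - fps_X)) $ n $ i"
    unfolding J_def \<sigma>_def .
qed

theorem theorem3p13:
  shows "A_gf [2,1,4,3] =
           1 + I_gf [2,1,4,3] + fps_X * (A_gf [2,1,4,3] - 1)
             + fps_X / (1 - fps_X) * (I_gf [2,1,4,3] - fps_X) \<and>
         I_gf1 [2,1,4,3] = (1 - fps_X)\<^sup>2 * E_gf + 2 * fps_X - 1 \<and>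
         I_total [2,1,4,3] 1 = 1 \<and>
         (\<forall>n\<ge>2. int (I_total [2,1,4,3] n) =
           int (E_count n) - 2 * int (E_count (n - 1)) + int (E_count (n - 2)))"
  by (intro conjI allI impI A_gf_2143 I_gf1_2143 I_total_1 I_total_2143) simp_all

end
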